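(* Let $X$ be the two-dimensional space $\mathbb{R}^2$ endowed with a norm whose unit sphere is a regular dodecagon (the boundary of a regular $12$-sided polygon). Then $DW(X)=8(2-\sqrt{3})$. Moreover, $dw(u,v)<DW(X)$ for all $u,v\in S_X$ with $u+v\neq0$, where $$dw(u,v)=\frac{\|u+v\|}{\inf_{0<\gamma<\frac{1}{2}}\|\gamma u+(1-\gamma) v\|}.$$
   Context: For a real normed linear space $X$, $S_X=\{x\in X:\|x\|=1\}$ denotes its unit sphere, and the Dunkl--Williams constant of $X$ is $$DW(X)=\sup\left\{\frac{\|x\|+\|y\|}{\|x-y\|}\left\|\frac{x}{\|x\|}-\frac{y}{\|y\|}\right\|:\ x,y\in X\setminus\{0\},\ x\neq y\right\}.$$ *)

theory Defs
  imports "HOL-Analysis.Analysis"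
begin

text \<open>
  The type \<^typ>\<open>real^2\<close> already carries the Euclidean norm of the library, so the norm of the
  space under consideration is an explicit function \<open>N\<close>.
\<close>

definition is_norm :: "('a::real_vector \<Rightarrow> real) \<Rightarrow> bool" where
  "is_norm N \<longleftrightarrow>
     (\<forall>x. 0 \<le> N x) \<and>
     (\<forall>x. N x = 0 \<longleftrightarrow> x = 0) \<and>
     (\<forall>a x. N (a *\<^sub>R x) = \<bar>a\<bar> * N x) \<and>
     (\<forall>x y. N (x + y) \<le> N x + N y)"

definition unit_sphere :: "('a::real_vector \<Rightarrow> real) \<Rightarrow> 'a set" where
  "unit_sphere N = {x. N x = 1}"

text \<open>
  For a norm \<open>N\<close> the set below is bounded above (by 4), and it is nonempty as soon as the space is
  nonzero, so the supremum in \<^typ>\<open>real\<close> is the genuine one.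
\<close>

definition DW :: "('a::real_vector \<Rightarrow> real) \<Rightarrow> real" where
  "DW N = Sup {(N x + N y) / N (x - y) * N (x /\<^sub>R N x - y /\<^sub>R N y) | x y.
                 x \<noteq> 0 \<and> y \<noteq> 0 \<and> x \<noteq> y}"

definition dw :: "('a::real_vector \<Rightarrow> real) \<Rightarrow> 'a \<Rightarrow> 'a \<Rightarrow> real" where
  "dw N u v = N (u + v) / (INF \<gamma>\<in>{0<..<1/2}. N (\<gamma> *\<^sub>R u + (1 - \<gamma>) *\<^sub>R v))"

text \<open>
  Regularity is meant in the Euclidean sense; the polygon is the closed region. Centre, circumradius
  and orientation are arbitrary (when the boundary is the unit sphere of a norm, the centre is
  forced to be the origin by symmetry).
\<close>

definition regular_polygon :: "nat \<Rightarrow> (real^2) set \<Rightarrow> bool" where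
  "regular_polygon n P \<longleftrightarrow> 3 \<le> n \<and>
     (\<exists>(c::real^2) (r::real) (\<theta>::real). 0 < r \<and>
        P = convex hull
              ((\<lambda>k. c + r *\<^sub>R vector [cos (\<theta> + 2 * pi * real k / real n),
                                    sin (\<theta> + 2 * pi * real k / real n)]) ` {..<n}))"

end

(* Compare the norm N with the Euclidean norm |.|: for circumradius r the dodecagon lies between the
   circles of radius r cos 15 and r, so |x| / r <= N x <= |x| / (r cos 15).  A point of the line
   through u and v has Euclidean length at least |u x v| / |u - v|, hence a quotient
   N (u + v) / N (g u + (1 - g) v) is at most |u + v| |u - v| / (cos 15 |u x v|).  Since
   |u + v|^2 |u - v|^2 = (|u|^2 - |v|^2)^2 + 4 |u x v|^2, this is below 2 / (cos 15)^2 as soon as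
   ||u|^2 - |v|^2| < 2 tan 15 |u x v|, which holds for all non-parallel u, v on the dodecagon.
   Equality is approached when u is a vertex and v tends to -u along an edge at -u. *)

theory Submission
  imports Defs
begin

section \<open>Polar directions and the planar cross product\<close>

definition direction :: "real \<Rightarrow> real^2" where
  "direction a = vector [cos a, sin a]"

definition cross2 :: "real^2 \<Rightarrow> real^2 \<Rightarrow> real" where
  "cross2 u v = u$1 * v$2 - u$2 * v$1"

lemma direction_nth [simp]: "direction a $ 1 = cos a" "direction a $ 2 = sin a"
  by (simp_all add: direction_def)

lemma inner_direction: "inner (direction a) (direction b) = cos (a - b)"
  by (simp add: inner_vec_def sum_2 cos_diff)

lemma norm_direction [simp]: "norm (direction a) = 1"
  by (simp add: norm_eq_1 inner_direction)

lemma direction_add_2pi_int: "direction (a + 2 * pi * of_int n) = direction a"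
  by (simp add: direction_def cos_add sin_add)

lemma direction_add_pi: "direction (a + pi) = - direction a"
  by (simp add: vec_eq_iff forall_2)

lemma direction_polar:
  fixes x :: "real^2"
  obtains \<phi> where "x = norm x *\<^sub>R direction \<phi>"
proof (cases "x = 0")
  case True
  then show ?thesis using that by simp
next
  case False
  have "(x$1)\<^sup>2 + (x$2)\<^sup>2 = (norm x)\<^sup>2"
    unfolding power2_norm_eq_inner inner_vec_def sum_2 inner_real_def by algebra
  then have "(x$1 / norm x)\<^sup>2 + (x$2 / norm x)\<^sup>2 = 1"
    using False by (simp add: power_divide flip: add_divide_distrib)
  then obtain \<phi> where "0 \<le> \<phi>" "\<phi> < 2 * pi"
    "x$1 / norm x = cos \<phi>" "x$2 / norm x = sin \<phi>"
    by (rule sincos_total_2pi)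
  then have "x$1 = norm x * cos \<phi>" "x$2 = norm x * sin \<phi>"
    using False by (simp_all add: nonzero_divide_eq_eq mult.commute)
  then have "x = norm x *\<^sub>R direction \<phi>"
    unfolding vec_eq_iff forall_2 vector_scaleR_component direction_nth real_scaleR_def by (rule conjI)
  then show ?thesis by (rule that)
qed

text \<open>The left side is \<open>(|u|^2 + |v|^2)^2 - 4 * (inner u v)^2\<close>; Lagrange's
  identity \<open>(inner u v)^2 + (cross2 u v)^2 = |u|^2 * |v|^2\<close> then eliminates the inner
  product.\<close>

lemma norm_sum_diff_cross2:
  "(norm (u + v) * norm (u - v))\<^sup>2 = ((norm u)\<^sup>2 - (norm v)\<^sup>2)\<^sup>2 + 4 * (cross2 u v)\<^sup>2"
  unfolding power_mult_distrib power2_norm_eq_inner inner_vec_def sum_2 inner_real_def cross2_def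
    vector_add_component vector_minus_component
  by (simp add: power2_eq_square algebra_simps)

lemma cross2_le_norm: "\<bar>cross2 u v\<bar> \<le> norm u * norm v"
proof -
  have "(cross2 u v)\<^sup>2 + (inner u v)\<^sup>2 = (norm u * norm v)\<^sup>2"
    unfolding power_mult_distrib power2_norm_eq_inner inner_vec_def sum_2 inner_real_def cross2_def
    by algebra
  then have "(cross2 u v)\<^sup>2 \<le> (norm u * norm v)\<^sup>2"
    using zero_le_power2[of "inner u v"] by linarith
  then show ?thesis
    by (metis abs_le_square_iff abs_mult abs_norm_cancel)
qed

lemma cross2_le_norm_line:
  "\<bar>cross2 u v\<bar> \<le> norm (\<gamma> *\<^sub>R u + (1 - \<gamma>) *\<^sub>R v) * norm (u - v)"
proof -
  \<comment> \<open>The cross product with the direction \<open>u - v\<close> is constant along the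
    line through \<open>u\<close> and \<open>v\<close>.\<close>
  have "cross2 (\<gamma> *\<^sub>R u + (1 - \<gamma>) *\<^sub>R v) (u - v) = - cross2 u v"
    by (simp add: cross2_def algebra_simps)
  then show ?thesis
    using cross2_le_norm[of "\<gamma> *\<^sub>R u + (1 - \<gamma>) *\<^sub>R v" "u - v"] by simp
qed

lemma cross2_eq_0_imp_parallel:
  assumes "cross2 u v = 0" "v \<noteq> 0"
  shows "\<exists>a. u = a *\<^sub>R v"
proof (cases "v$1 = 0")
  case True
  with assms(2) have "v$2 \<noteq> 0" by (auto simp: vec_eq_iff forall_2)
  with True assms(1) have "u = (u$2 / v$2) *\<^sub>R v"
    by (auto simp: cross2_def vec_eq_iff forall_2)
  then show ?thesis by blast
next
  case False
  with assms(1) have "u = (u$1 / v$1) *\<^sub>R v"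
    by (auto simp: cross2_def vec_eq_iff forall_2 field_simps)
  then show ?thesis by blast
qed

section \<open>Trigonometry of the angle pi/12\<close>

abbreviation "cos15 \<equiv> cos (pi / 12)"
abbreviation "sin15 \<equiv> sin (pi / 12)"

lemma cos15_pos: "0 < cos15" and sin15_pos: "0 < sin15"
  by (auto intro: cos_gt_zero sin_gt_zero simp: field_simps)

lemma cos15_lt_1: "cos15 < 1"
  using cos_monotone_0_pi[of 0 "pi/12"] by simp

lemma sin15_cos15: "sin15 * cos15 = 1 / 4"
  using sin_double[of "pi/12"] by (simp add: sin_30)

lemma cos15_sq_minus: "cos15\<^sup>2 - sin15\<^sup>2 = sqrt 3 / 2"
  using cos_double[of "pi/12"] by (simp add: cos_30)

lemma cos15_sq: "cos15\<^sup>2 = (2 + sqrt 3) / 4"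
  using cos15_sq_minus unfolding sin_squared_eq by simp

lemma two_div_cos15_sq: "2 / cos15\<^sup>2 = 8 * (2 - sqrt 3)"
proof -
  have "2 + sqrt 3 \<noteq> 0" using real_sqrt_ge_zero[of 3] by linarith
  then show ?thesis by (simp add: cos15_sq field_simps)
qed

text \<open>Twice the expansion of cos(pi/6 - pi/12), whose value is again
  \<open>cos15\<close>.\<close>

lemma sqrt3_cos15: "sqrt 3 * cos15 + sin15 = 2 * cos15"
  using cos_diff[of "pi/6" "pi/12"] by (simp add: cos_30 sin_30)

lemma sin15_lt_cos15: "sin15 < cos15"
proof (rule power2_less_imp_less)
  have "0 < sqrt 3 / 2" by simp
  then show "sin15\<^sup>2 < cos15\<^sup>2" using cos15_sq_minus by linarith
qed (use cos15_pos in simp)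

section \<open>Edges of the dodecagon in coordinates\<close>

text \<open>The edge with outward normal at angle \<open>a\<close> of the dodecagon with circumradius \<open>1\<close> consists of
  the points \<open>edge_point a s\<close> with \<open>\<bar>s\<bar> \<le> sin15\<close>.\<close>

definition edge_point :: "real \<Rightarrow> real \<Rightarrow> real^2" where
  "edge_point a s = cos15 *\<^sub>R direction a + s *\<^sub>R direction (a + pi / 2)"

lemma edge_point_nth:
  "edge_point a s $ 1 = cos15 * cos a - s * sin a"
  "edge_point a s $ 2 = cos15 * sin a + s * cos a"
  by (simp_all add: edge_point_def cos_add sin_add)

lemma norm_edge_point: "(norm (edge_point a s))\<^sup>2 = cos15\<^sup>2 + s\<^sup>2"
proof -
  have "(norm (edge_point a s))\<^sup>2 = (cos15\<^sup>2 + s\<^sup>2) * ((sin a)\<^sup>2 + (cos a)\<^sup>2)"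
    unfolding power2_norm_eq_inner inner_vec_def sum_2 edge_point_nth inner_real_def
    by algebra
  then show ?thesis by simp
qed

lemma cross2_edge_point:
  "cross2 (edge_point a s) (edge_point b t) =
     (cos15\<^sup>2 + s * t) * sin (b - a) + cos15 * (t - s) * cos (b - a)"
  unfolding cross2_def edge_point_nth sin_diff cos_diff by algebra

lemma edge_point_vertices:
  "edge_point a sin15 = direction (a + pi / 12)"
  "edge_point a (- sin15) = direction (a - pi / 12)"
  by (simp_all add: vec_eq_iff forall_2 edge_point_nth cos_add sin_add cos_diff sin_diff)

section \<open>The key inequality for each relative position of two edges\<close>

text \<open>On a single edge the cross product is \<open>cos15 * (t - s)\<close>. Cancelling
  \<open>t - s\<close> leaves \<open>\<bar>s + t\<bar> < 2 * sin15\<close>, strict because two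
  distinct offsets are not at the same endpoint.\<close>

lemma edge_ineq_same:
  fixes s t :: real
  assumes "\<bar>s\<bar> \<le> sin15" "\<bar>t\<bar> \<le> sin15" "s \<noteq> t"
  shows "cos15 * \<bar>s\<^sup>2 - t\<^sup>2\<bar> < 2 * sin15 * \<bar>cos15 * (t - s)\<bar>"
proof -
  have "\<bar>s\<^sup>2 - t\<^sup>2\<bar> = \<bar>s + t\<bar> * \<bar>t - s\<bar>"
    by (simp add: power2_eq_square abs_minus_commute square_diff_square_factored flip: abs_mult)
  moreover have "\<bar>s + t\<bar> < 2 * sin15" using assms by linarith
  ultimately show ?thesis using assms(3) cos15_pos by (simp add: abs_mult)
qed

text \<open>In the distances \<open>a\<close>, \<open>b\<close> from the common vertex of two adjacent edges, the cross product is
  \<open>cos15 * (a + b) - a * b / 2\<close>.\<close>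

lemma edge_ineq_adjacent:
  fixes s t :: real
  defines "X \<equiv> (cos15\<^sup>2 + s * t) * (1/2) + cos15 * (t - s) * (sqrt 3 / 2)"
  assumes "\<bar>s\<bar> \<le> sin15" "\<bar>t\<bar> \<le> sin15" "X \<noteq> 0"
  shows "cos15 * \<bar>s\<^sup>2 - t\<^sup>2\<bar> < 2 * sin15 * \<bar>X\<bar>"
proof -
  define a where "a = sin15 - s"
  define b where "b = t + sin15"
  have ab: "0 \<le> a" "a \<le> 2 * sin15" "0 \<le> b" "b \<le> 2 * sin15"
    using assms(2,3) by (auto simp: a_def b_def abs_le_iff)
  have st: "s = sin15 - a" "t = b - sin15" by (simp_all add: a_def b_def)
  have X: "X = cos15 * (a + b) - a * b / 2"
  proof -
    have 1: "sin15 * (sqrt 3 * cos15) = sqrt 3 / 4"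
      using sin15_cos15 by (simp add: algebra_simps)
    have 2: "sqrt 3 * cos15 = 2 * cos15 - sin15" using sqrt3_cos15 by simp
    have "2 * X = (cos15\<^sup>2 - sin15\<^sup>2) + sin15 * (a + b) - a * b
        + (sqrt 3 * cos15) * (a + b) - 2 * (sin15 * (sqrt 3 * cos15))"
      unfolding X_def st by algebra
    also have "\<dots> = 2 * cos15 * (a + b) - a * b"
      unfolding cos15_sq_minus 1 unfolding 2 by (simp add: algebra_simps)
    finally show ?thesis by simp
  qed
  have D: "\<bar>s\<^sup>2 - t\<^sup>2\<bar> = \<bar>b - a\<bar> * \<bar>2 * sin15 - (a + b)\<bar>"
    unfolding st abs_mult[symmetric] by (rule arg_cong[where f = abs]) algebra
  have a0b0: "a \<noteq> 0 \<or> b \<noteq> 0" using X assms(4) by auto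
  \<comment> \<open>The larger of \<open>a\<close> and \<open>b\<close> is at most the edge length
    \<open>2 * sin15\<close>.\<close>
  have mix: "a * b \<le> 2 * sin15 * min a b"
    using ab mult_left_mono[of b "2 * sin15" a] mult_right_mono[of a "2 * sin15" b]
    by (auto simp: min_def mult.commute)
  have sm: "sin15 * min a b \<le> cos15 * min a b"
    using ab sin15_lt_cos15 by (intro mult_right_mono) auto
  \<comment> \<open>Of the two copies of \<open>cos15 * min a b\<close> in
    \<open>cos15 * (a + b)\<close>, one pays for \<open>a * b / 2\<close>.\<close>
  have Xge: "cos15 * \<bar>b - a\<bar> + cos15 * min a b \<le> X"
  proof -
    have "a + b = \<bar>b - a\<bar> + 2 * min a b" by (auto simp: min_def)
    then have "cos15 * (a + b) = cos15 * \<bar>b - a\<bar> + 2 * (cos15 * min a b)"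
      by (simp add: distrib_left)
    moreover have "a * b \<le> 2 * (sin15 * min a b)" using mix by (simp only: mult.assoc)
    ultimately show ?thesis using sm unfolding X by linarith
  qed
  have mab: "0 \<le> cos15 * min a b" using ab cos15_pos by simp
  have "cos15 * \<bar>s\<^sup>2 - t\<^sup>2\<bar> \<le> cos15 * (\<bar>b - a\<bar> * (2 * sin15))"
    unfolding D using ab cos15_pos by (intro mult_left_mono) auto
  then have le: "cos15 * \<bar>s\<^sup>2 - t\<^sup>2\<bar> \<le> 2 * sin15 * (cos15 * \<bar>b - a\<bar>)"
    by (simp only: mult_ac)
  \<comment> \<open>Strictness has two sources. If neither point is the common vertex,
    \<open>Xge\<close> has a positive term to spare; if exactly one is, then
    \<open>0 < a + b\<close> and the last factor in \<open>D\<close> is strictly below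
    \<open>2 * sin15\<close>.\<close>
  show ?thesis
  proof (cases "min a b = 0")
    case False
    then have "0 < cos15 * min a b" using ab cos15_pos by (auto simp: min_def)
    then have "cos15 * \<bar>b - a\<bar> < \<bar>X\<bar>" using Xge by linarith
    then have "2 * sin15 * (cos15 * \<bar>b - a\<bar>) < 2 * sin15 * \<bar>X\<bar>" using sin15_pos by simp
    with le show ?thesis by linarith
  next
    case True
    with a0b0 ab have ba: "0 < \<bar>b - a\<bar>" by (auto simp: min_def split: if_splits)
    have "\<bar>2 * sin15 - (a + b)\<bar> < 2 * sin15"
      using True a0b0 ab by (auto simp: min_def abs_less_iff split: if_splits)
    then have "cos15 * (\<bar>b - a\<bar> * \<bar>2 * sin15 - (a + b)\<bar>) < cos15 * (\<bar>b - a\<bar> * (2 * sin15))"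
      using ba cos15_pos by simp
    then have "cos15 * \<bar>s\<^sup>2 - t\<^sup>2\<bar> < 2 * sin15 * (cos15 * \<bar>b - a\<bar>)"
      unfolding D by (simp add: mult_ac)
    also have "\<dots> \<le> 2 * sin15 * \<bar>X\<bar>"
      using Xge mab sin15_pos by (intro mult_left_mono) auto
    finally show ?thesis .
  qed
qed

text \<open>Crude bounds suffice: the left side is at most
  \<open>cos15 * sin15\<^sup>2 = sin15 / 4\<close>, the right side at least
  \<open>sin15 / 2\<close>.\<close>

lemma edge_ineq_far:
  fixes s t X :: real
  assumes "\<bar>s\<bar> \<le> sin15" "\<bar>t\<bar> \<le> sin15" "1 / 4 \<le> X"
  shows "cos15 * \<bar>s\<^sup>2 - t\<^sup>2\<bar> < 2 * sin15 * \<bar>X\<bar>"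
proof -
  have "s\<^sup>2 \<le> sin15\<^sup>2" "t\<^sup>2 \<le> sin15\<^sup>2"
    using assms sin15_pos by (auto simp: abs_le_square_iff[symmetric])
  then have "\<bar>s\<^sup>2 - t\<^sup>2\<bar> \<le> sin15\<^sup>2"
    using zero_le_power2[of s] zero_le_power2[of t] by linarith
  then have "cos15 * \<bar>s\<^sup>2 - t\<^sup>2\<bar> \<le> cos15 * sin15\<^sup>2" using cos15_pos by simp
  also have "\<dots> = sin15 * (sin15 * cos15)" by (simp add: power2_eq_square)
  also have "\<dots> = sin15 * (1/4)" unfolding sin15_cos15 ..
  also have "\<dots> < sin15 * (2 * X)" using assms(3) sin15_pos by (intro mult_strict_left_mono) auto
  also have "\<dots> \<le> 2 * sin15 * \<bar>X\<bar>" using sin15_pos by (simp add: mult.left_commute)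
  finally show ?thesis .
qed

text \<open>Here \<open>X\<close> is the cross product from \<open>cross2_edge_point\<close> for two
  edges whose normals differ by \<open>m\<close> steps of pi/6.\<close>

lemma edge_ineq:
  fixes s t :: real and m :: int
  defines "X \<equiv> (cos15\<^sup>2 + s * t) * sin (of_int m * pi / 6) + cos15 * (t - s) * cos (of_int m * pi / 6)"
  assumes s: "\<bar>s\<bar> \<le> sin15" and t: "\<bar>t\<bar> \<le> sin15" and X0: "X \<noteq> 0"
  shows "cos15 * \<bar>s\<^sup>2 - t\<^sup>2\<bar> < 2 * sin15 * \<bar>X\<bar>"
proof -
  \<comment> \<open>A half turn, six steps, only flips the sign of \<open>X\<close>, so the residue
    of \<open>m\<close> modulo 6 decides.\<close>
  define d where "d = m div 6"
  define j where "j = m mod 6"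
  have mj: "m = 6 * d + j" by (simp add: d_def j_def)
  define Y where "Y = (cos15\<^sup>2 + s * t) * sin (of_int j * pi / 6)
      + cos15 * (t - s) * cos (of_int j * pi / 6)"
  have ang: "of_int m * pi / 6 = of_int j * pi / 6 + of_int d * pi"
    by (simp add: mj field_simps)
  have "sin (of_int d * pi) = 0" by (simp add: sin_zero_iff_int2)
  moreover from this have "\<bar>cos (of_int d * pi)\<bar> = 1"
    by (metis abs_square_eq_1 add_0 power_zero_numeral sin_cos_squared_add)
  moreover have "X = Y * cos (of_int d * pi)"
    unfolding X_def Y_def ang sin_add cos_add using \<open>sin (of_int d * pi) = 0\<close>
    by (simp add: algebra_simps)
  ultimately have XY: "\<bar>X\<bar> = \<bar>Y\<bar>" by (simp add: abs_mult)
  with X0 have Y0: "Y \<noteq> 0" by auto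
  have st: "\<bar>s * t\<bar> \<le> sin15\<^sup>2"
    using mult_mono[OF s t] sin15_pos by (simp add: abs_mult power2_eq_square)
  \<comment> \<open>These bounds serve residues 2, 3, 4: for 2 and 4 they give at least 3/4 - 1/4,
    and for 3 the cross product is \<open>cos15\<^sup>2 + s * t\<close> itself.\<close>
  have c2: "sqrt 3 / 2 \<le> cos15\<^sup>2 + s * t" using st cos15_sq_minus by linarith
  have d2: "cos15 * \<bar>t - s\<bar> \<le> 1 / 2"
  proof -
    have "cos15 * \<bar>t - s\<bar> \<le> cos15 * (2 * sin15)"
      using s t cos15_pos by (intro mult_left_mono) auto
    also have "\<dots> = 1 / 2" using sin15_cos15 by (simp add: mult.commute)
    finally show ?thesis .
  qed
  have s3: "sqrt 3 * sqrt 3 = 3" by simp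
  have "1 / 4 \<le> sqrt 3 / 2" using real_sqrt_ge_1_iff[of 3] by linarith
  then have c4: "1 / 4 \<le> cos15\<^sup>2 + s * t" using c2 by (rule order_trans)
  have c60: "3 / 4 \<le> (cos15\<^sup>2 + s * t) * (sqrt 3 / 2)"
    using mult_right_mono[OF c2, of "sqrt 3 / 2"] s3 by simp
  have ts: "cos15 * (t - s) \<le> 1/2" "- (1/2) \<le> cos15 * (t - s)"
    using d2 abs_ge_self[of "cos15 * (t - s)"] abs_ge_minus_self[of "cos15 * (t - s)"] cos15_pos
    by (simp_all only: abs_mult abs_of_pos)
  have "j \<in> {0,1,2,3,4,5}" by (auto simp: j_def)
  then consider "j = 0" | "j = 1" | "j = 2" | "j = 3" | "j = 4" | "j = 5" by auto
  then have "cos15 * \<bar>s\<^sup>2 - t\<^sup>2\<bar> < 2 * sin15 * \<bar>Y\<bar>"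
  proof cases
    case 1
    then show ?thesis using edge_ineq_same[OF s t] Y0 unfolding Y_def by auto
  next
    case 2
    then show ?thesis using edge_ineq_adjacent[OF s t] Y0 unfolding Y_def
      by (simp add: sin_30 cos_30)
  next
    case 3
    then have a: "of_int j * pi / 6 = pi / 3" by simp
    show ?thesis using c60 ts unfolding Y_def a
      by (intro edge_ineq_far[OF s t]) (unfold sin_60 cos_60, linarith)
  next
    case 4
    then have a: "of_int j * pi / 6 = pi / 2" by simp
    show ?thesis using c4 unfolding Y_def a
      by (intro edge_ineq_far[OF s t]) (unfold sin_pi_half cos_pi_half, simp)
  next
    case 5
    then have a: "of_int j * pi / 6 = pi - pi / 3" by simp
    show ?thesis using c60 ts unfolding Y_def a sin_pi_minus cos_pi_minus
      by (intro edge_ineq_far[OF s t]) (unfold sin_60 cos_60, linarith)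
  next
    case 6
    then have a: "of_int j * pi / 6 = pi - pi / 6" by simp
    \<comment> \<open>Replacing the second edge by its opposite makes the edges adjacent in the
      reverse order, hence the swap of \<open>s\<close> and \<open>t\<close>.\<close>
    have Y: "Y = (cos15\<^sup>2 + t * s) * (1/2) + cos15 * (s - t) * (sqrt 3 / 2)"
      unfolding Y_def a sin_pi_minus cos_pi_minus by (simp add: sin_30 cos_30 algebra_simps)
    then show ?thesis using edge_ineq_adjacent[OF t s] Y0
      by (simp add: abs_minus_commute)
  qed
  then show ?thesis unfolding XY .
qed

section \<open>Norms whose unit sphere is a dodecagon centred at the origin\<close>

text \<open>The angle \<theta> is the outward normal of an edge, not the direction of a vertex.
  Letting \<open>k\<close> range over all integers repeats each edge with period 12 and spares index
  reductions.\<close>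

locale dodecagon_norm =
  fixes N :: "real^2 \<Rightarrow> real" and r \<theta> :: real
  assumes norm_N: "is_norm N" and r_pos: "0 < r"
    and sphere: "N x = 1 \<longleftrightarrow>
      (\<exists>(k::int) s. \<bar>s\<bar> \<le> sin15 \<and> x = r *\<^sub>R edge_point (\<theta> + of_int k * pi / 6) s)"
begin

lemma N_nonneg: "0 \<le> N x" and N_eq_0: "N x = 0 \<longleftrightarrow> x = 0"
  and N_scale: "N (a *\<^sub>R x) = \<bar>a\<bar> * N x"
  using norm_N unfolding is_norm_def by blast+

lemma N_minus: "N (- x) = N x"
  using N_scale[of "-1" x] by simp

lemma norm_bounds_sphere:
  assumes "N x = 1"
  shows "r * cos15 \<le> norm x" "norm x \<le> r"
proof -
  obtain a s where s: "\<bar>s\<bar> \<le> sin15" and x: "x = r *\<^sub>R edge_point a s"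
    using assms sphere by metis
  have "s\<^sup>2 \<le> sin15\<^sup>2" using s sin15_pos by (simp flip: abs_le_square_iff)
  then have "(norm (edge_point a s))\<^sup>2 \<le> 1\<^sup>2" "cos15\<^sup>2 \<le> (norm (edge_point a s))\<^sup>2"
    unfolding norm_edge_point sin_squared_eq by simp_all
  then have "norm (edge_point a s) \<le> 1" "cos15 \<le> norm (edge_point a s)"
    using power2_le_imp_le by (blast intro: norm_ge_zero zero_le_one)+
  then show "r * cos15 \<le> norm x" "norm x \<le> r"
    using r_pos unfolding x by auto
qed

lemma norm_bounds: "r * cos15 * N x \<le> norm x" "norm x \<le> r * N x"
proof -
  have "r * cos15 * N x \<le> norm x \<and> norm x \<le> r * N x"
  proof (cases "x = 0")
    case True
    then show ?thesis using N_eq_0[of x] by simp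
  next
    case False
    then have p: "0 < N x" using N_nonneg[of x] N_eq_0[of x] by linarith
    then have "N ((1 / N x) *\<^sub>R x) = 1" by (simp add: N_scale)
    from norm_bounds_sphere[OF this] show ?thesis using p by (simp add: field_simps)
  qed
  then show "r * cos15 * N x \<le> norm x" "norm x \<le> r * N x" by auto
qed

text \<open>Both sides scale with \<open>r\<^sup>2\<close> and depend on the two edges only through
  the difference of their indices, so \<open>edge_ineq\<close> applies.\<close>

lemma cross2_sphere:
  assumes "N u = 1" "N v = 1" "cross2 u v \<noteq> 0"
  shows "cos15 * \<bar>(norm u)\<^sup>2 - (norm v)\<^sup>2\<bar> < 2 * sin15 * \<bar>cross2 u v\<bar>"
proof -
  obtain k s where s: "\<bar>s\<bar> \<le> sin15" and u: "u = r *\<^sub>R edge_point (\<theta> + of_int k * pi / 6) s"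
    using assms sphere by metis
  obtain l t where t: "\<bar>t\<bar> \<le> sin15" and v: "v = r *\<^sub>R edge_point (\<theta> + of_int l * pi / 6) t"
    using assms sphere by metis
  define X where "X = (cos15\<^sup>2 + s * t) * sin (of_int (l - k) * pi / 6)
      + cos15 * (t - s) * cos (of_int (l - k) * pi / 6)"
  have "cross2 u v = r\<^sup>2 * cross2 (edge_point (\<theta> + of_int k * pi / 6) s)
      (edge_point (\<theta> + of_int l * pi / 6) t)"
    unfolding u v by (simp add: cross2_def power2_eq_square algebra_simps)
  also have "\<dots> = r\<^sup>2 * X"
  proof -
    have "(\<theta> + of_int l * pi / 6) - (\<theta> + of_int k * pi / 6) = of_int (l - k) * pi / 6"
      by (simp add: field_simps)
    then show ?thesis unfolding cross2_edge_point X_def by (simp only:)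
  qed
  finally have cr: "cross2 u v = r\<^sup>2 * X" .
  have "(norm u)\<^sup>2 - (norm v)\<^sup>2 = r\<^sup>2 * (s\<^sup>2 - t\<^sup>2)"
    unfolding u v by (simp add: power_mult_distrib norm_edge_point algebra_simps)
  then have D: "\<bar>(norm u)\<^sup>2 - (norm v)\<^sup>2\<bar> = r\<^sup>2 * \<bar>s\<^sup>2 - t\<^sup>2\<bar>" by (simp add: abs_mult)
  have "X \<noteq> 0" using assms(3) cr by auto
  then have "cos15 * \<bar>s\<^sup>2 - t\<^sup>2\<bar> < 2 * sin15 * \<bar>X\<bar>"
    unfolding X_def by (intro edge_ineq s t)
  then have "r\<^sup>2 * (cos15 * \<bar>s\<^sup>2 - t\<^sup>2\<bar>) < r\<^sup>2 * (2 * sin15 * \<bar>X\<bar>)"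
    using r_pos by simp
  then show ?thesis unfolding D cr by (simp add: abs_mult mult_ac)
qed

section \<open>Upper bounds for \<open>dw\<close> and \<open>DW\<close>\<close>

text \<open>The bound \<open>L\<close> is uniform in \<gamma>, so the strict inequality survives the
  infimum in \<open>dw\<close>; covering all real \<gamma> also serves the weights arising in
  \<open>DW\<close>.\<close>

lemma sum_lt_line_bound:
  assumes u: "N u = 1" and v: "N v = 1" and uv: "u + v \<noteq> 0"
  obtains L where "0 < L" "N (u + v) < 2 / cos15\<^sup>2 * L"
    "\<And>\<gamma>. L \<le> N (\<gamma> *\<^sub>R u + (1 - \<gamma>) *\<^sub>R v)"
proof (cases "cross2 u v = 0")
  case True
  have "v \<noteq> 0" using v N_eq_0[of v] by auto
  then obtain a where a: "u = a *\<^sub>R v" using cross2_eq_0_imp_parallel[OF True] by blast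
  with u v have "\<bar>a\<bar> = 1" by (simp add: N_scale)
  \<comment> \<open>The value \<open>a = -1\<close> would give \<open>u + v = 0\<close>.\<close>
  with a uv have u_eq: "u = v" by (auto simp: abs_if split: if_splits)
  have "u + v = 2 *\<^sub>R v" using u_eq by (simp add: scaleR_2)
  then have "N (u + v) = 2" using v by (simp add: N_scale)
  moreover have "2 < 2 / cos15\<^sup>2 * 1"
    using cos15_pos cos15_lt_1 by (simp add: field_simps power_less_one_iff abs_square_less_1)
  moreover have "\<gamma> *\<^sub>R u + (1 - \<gamma>) *\<^sub>R v = v" for \<gamma>
    by (simp add: u_eq flip: scaleR_add_left)
  ultimately show ?thesis using that[of 1] v by simp
next
  case False
  let ?X = "\<bar>cross2 u v\<bar>"
  have X: "0 < ?X" using False by simp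
  have "u \<noteq> v" using False by (auto simp: cross2_def)
  then have d: "0 < norm (u - v)" by simp
  have lt: "cos15 * (norm (u + v) * norm (u - v)) < 2 * ?X"
  proof -
    let ?D = "(norm u)\<^sup>2 - (norm v)\<^sup>2"
    \<comment> \<open>After squaring, \<open>sin15\<^sup>2 = 1 - cos15\<^sup>2\<close> completes the
      left side to the expression in \<open>norm_sum_diff_cross2\<close>.\<close>
    have "(cos15 * \<bar>?D\<bar>)\<^sup>2 < (2 * sin15 * ?X)\<^sup>2"
      using cross2_sphere[OF u v False] cos15_pos by (intro power_strict_mono) auto
    then have "cos15\<^sup>2 * ?D\<^sup>2 < 4 * sin15\<^sup>2 * (cross2 u v)\<^sup>2"
      by (simp add: power_mult_distrib)
    also have "\<dots> = 4 * (cross2 u v)\<^sup>2 - cos15\<^sup>2 * (4 * (cross2 u v)\<^sup>2)"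
      by (simp add: sin_squared_eq algebra_simps)
    finally have "cos15\<^sup>2 * (?D\<^sup>2 + 4 * (cross2 u v)\<^sup>2) < 4 * (cross2 u v)\<^sup>2"
      by (simp add: distrib_left)
    then have "(cos15 * (norm (u + v) * norm (u - v)))\<^sup>2 < (2 * ?X)\<^sup>2"
      unfolding power_mult_distrib[of cos15] norm_sum_diff_cross2 by (simp add: power_mult_distrib)
    then show ?thesis by (rule power2_less_imp_less) simp
  qed
  \<comment> \<open>The Euclidean distance from the origin to the line through \<open>u\<close> and
    \<open>v\<close>, divided by \<open>r\<close> to bound \<open>N\<close> from below.\<close>
  define L where "L = ?X / (r * norm (u - v))"
  have "0 < L" unfolding L_def using X d r_pos by simp
  moreover have "N (u + v) < 2 / cos15\<^sup>2 * L"
  proof -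
    have "r * cos15 * N (u + v) * (cos15 * norm (u - v)) \<le> norm (u + v) * (cos15 * norm (u - v))"
      using norm_bounds(1)[of "u + v"] cos15_pos by (intro mult_right_mono) auto
    also have "\<dots> < 2 * ?X" using lt by (simp add: mult_ac)
    finally show ?thesis
      unfolding L_def using r_pos d cos15_pos
      by (simp add: field_simps power2_eq_square)
  qed
  moreover have "L \<le> N (\<gamma> *\<^sub>R u + (1 - \<gamma>) *\<^sub>R v)" for \<gamma>
  proof -
    have "?X \<le> norm (\<gamma> *\<^sub>R u + (1 - \<gamma>) *\<^sub>R v) * norm (u - v)"
      by (rule cross2_le_norm_line)
    also have "\<dots> \<le> r * N (\<gamma> *\<^sub>R u + (1 - \<gamma>) *\<^sub>R v) * norm (u - v)"
      by (intro mult_right_mono norm_bounds) simp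
    finally show ?thesis unfolding L_def using r_pos d by (simp add: field_simps)
  qed
  ultimately show ?thesis by (rule that)
qed

lemma dw_less:
  assumes "N u = 1" "N v = 1" "u + v \<noteq> 0"
  shows "dw N u v < 2 / cos15\<^sup>2"
proof -
  obtain L where L: "0 < L" "N (u + v) < 2 / cos15\<^sup>2 * L"
    "\<And>\<gamma>. L \<le> N (\<gamma> *\<^sub>R u + (1 - \<gamma>) *\<^sub>R v)"
    using sum_lt_line_bound[OF assms] by blast
  let ?I = "INF \<gamma>\<in>{0<..<1/2}. N (\<gamma> *\<^sub>R u + (1 - \<gamma>) *\<^sub>R v)"
  have "L \<le> ?I" by (rule cINF_greatest) (auto intro: L)
  then have "dw N u v \<le> N (u + v) / L"
    unfolding dw_def using L(1) by (intro divide_left_mono) (auto simp: N_nonneg)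
  also have "\<dots> < 2 / cos15\<^sup>2" using L by (simp add: field_simps)
  finally show ?thesis .
qed

text \<open>Since \<open>\<gamma> *\<^sub>R u + (1 - \<gamma>) *\<^sub>R v\<close> is
  \<open>x - y\<close> divided by \<open>N x + N y\<close>, the quotient is \<open>N (u + v)\<close>
  over the norm of a point on the line through \<open>u\<close> and \<open>v\<close>.\<close>

lemma ratio_le:
  assumes "x \<noteq> 0" "y \<noteq> 0" "x \<noteq> y"
  shows "(N x + N y) / N (x - y) * N (x /\<^sub>R N x - y /\<^sub>R N y) \<le> 2 / cos15\<^sup>2"
proof -
  define u v \<gamma> where "u = x /\<^sub>R N x" and "v = - (y /\<^sub>R N y)" and "\<gamma> = N x / (N x + N y)"
  have p: "0 < N x" "0 < N y"
    using assms N_nonneg[of x] N_eq_0[of x] N_nonneg[of y] N_eq_0[of y] by linarith+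
  have uv: "N u = 1" "N v = 1" using p by (simp_all add: u_def v_def N_minus N_scale)
  have "1 - \<gamma> = N y / (N x + N y)" using p by (simp add: \<gamma>_def field_simps)
  then have "\<gamma> *\<^sub>R u + (1 - \<gamma>) *\<^sub>R v = (1 / (N x + N y)) *\<^sub>R (x - y)"
    using p by (simp add: u_def v_def \<gamma>_def scaleR_diff_right divide_simps)
  then have q: "N (\<gamma> *\<^sub>R u + (1 - \<gamma>) *\<^sub>R v) = N (x - y) / (N x + N y)"
    using p by (simp add: N_scale)
  have xy: "x /\<^sub>R N x - y /\<^sub>R N y = u + v" by (simp add: u_def v_def)
  show ?thesis
  proof (cases "u + v = 0")
    case True
    then show ?thesis unfolding xy using N_eq_0[of 0] by simp
  next
    case False
    obtain L where L: "0 < L" "N (u + v) < 2 / cos15\<^sup>2 * L"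
      "\<And>\<gamma>. L \<le> N (\<gamma> *\<^sub>R u + (1 - \<gamma>) *\<^sub>R v)"
      using sum_lt_line_bound[OF uv False] by blast
    have "2 / cos15\<^sup>2 * L \<le> 2 / cos15\<^sup>2 * (N (x - y) / (N x + N y))"
      using L(3)[of \<gamma>] unfolding q by (intro mult_left_mono) auto
    with L have "N (u + v) \<le> 2 / cos15\<^sup>2 * (N (x - y) / (N x + N y))" by linarith
    moreover have "0 < N (x - y)" using assms(3) N_nonneg[of "x - y"] N_eq_0[of "x - y"] by force
    ultimately have "(N x + N y) / N (x - y) * N (u + v) \<le>
        (N x + N y) / N (x - y) * (2 / cos15\<^sup>2 * (N (x - y) / (N x + N y)))"
      using p by (intro mult_left_mono) auto
    also have "\<dots> = 2 / cos15\<^sup>2" using p \<open>0 < N (x - y)\<close> add_pos_pos[OF p] by (simp del: distrib_right_numeral)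
    finally show ?thesis unfolding xy .
  qed
qed

text \<open>The supremum is approached by \<open>u\<close> a vertex and \<open>- v\<close> a point of an edge at \<open>u\<close> tending to
  \<open>u\<close>; the weight \<open>\<gamma>\<close> places \<open>\<gamma> u + (1 - \<gamma>) v\<close> on the vertex direction orthogonal to \<open>u\<close>.\<close>

lemma ratio_near_sup:
  assumes t: "0 < t" "t < sin15"
  shows "\<exists>x y. x \<noteq> 0 \<and> y \<noteq> 0 \<and> x \<noteq> y \<and>
    (2 * cos15\<^sup>2 + sin15 * (sin15 + t)) / cos15\<^sup>2 =
    (N x + N y) / N (x - y) * N (x /\<^sub>R N x - y /\<^sub>R N y)"
proof -
  \<comment> \<open>These values solve the linear equation \<open>key\<close> for \<eta>, which says
    that \<open>x - y\<close> points along a vertex.\<close>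
  define W where "W = 2 * cos15\<^sup>2 + sin15 * (sin15 + t)"
  define \<eta> where "\<eta> = sin15 * (sin15 - t) / (2 * W)"
  have W: "0 < W" unfolding W_def using cos15_pos sin15_pos t by (intro add_pos_pos) auto
  have \<eta>W: "2 * \<eta> * W = sin15 * (sin15 - t)" using W by (simp add: \<eta>_def)
  have \<eta>: "0 < \<eta>" unfolding \<eta>_def using W t sin15_pos by simp
  have "sin15 * (sin15 - t) < W"
    unfolding W_def using cos15_pos t sin15_pos by (simp add: algebra_simps add_pos_pos)
  then have \<eta>2: "\<eta> < 1/2" unfolding \<eta>_def using W by (simp add: field_simps)
  define p where "p = r *\<^sub>R edge_point \<theta> sin15"
  define q where "q = r *\<^sub>R edge_point \<theta> t"
  have "N (r *\<^sub>R edge_point (\<theta> + of_int 0 * pi / 6) s) = 1" if "\<bar>s\<bar> \<le> sin15" for s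
    using that sphere by blast
  then have pq: "N p = 1" "N q = 1" using t sin15_pos by (auto simp: p_def q_def)
  have N3: "N (r *\<^sub>R edge_point (\<theta> + of_int 3 * pi / 6) s) = 1" if "\<bar>s\<bar> \<le> sin15" for s
    using that sphere by blast
  have a3: "\<theta> + of_int 3 * pi / 6 = \<theta> + pi / 2" by simp
  define x where "x = (1/2 - \<eta>) *\<^sub>R p"
  define y where "y = (1/2 + \<eta>) *\<^sub>R q"
  have Nx: "N x = 1/2 - \<eta>" "N y = 1/2 + \<eta>" using \<eta> \<eta>2 pq by (simp_all add: x_def y_def N_scale)
  have xu: "x /\<^sub>R N x = p" "y /\<^sub>R N y = q"
    unfolding Nx using \<eta> \<eta>2 by (simp_all add: x_def y_def)
  \<comment> \<open>The difference points to the midpoint of an edge and \<open>x - y\<close> to a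
    vertex, so both comparisons of \<open>N\<close> with the Euclidean norm are equalities
    here.\<close>
  have pmq: "p - q = ((sin15 - t) / cos15) *\<^sub>R (r *\<^sub>R edge_point (\<theta> + pi / 2) 0)"
    unfolding p_def q_def using cos15_pos
    by (simp add: vec_eq_iff forall_2 edge_point_nth cos_add sin_add) (simp add: field_simps)
  have N1: "N (p - q) = (sin15 - t) / cos15"
    unfolding pmq N_scale using N3[of 0] a3 sin15_pos cos15_pos t by (simp add: N_scale)
  have key: "(1/2 - \<eta>) * sin15 - (1/2 + \<eta>) * t = 2 * \<eta> * cos15 * cos15 / sin15"
    using \<eta>W sin15_pos unfolding W_def by (simp add: field_simps power2_eq_square)
  have xmy: "x - y = (2 * \<eta> * cos15 / sin15) *\<^sub>R (r *\<^sub>R edge_point (\<theta> + pi / 2) sin15)"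
  proof -
    have "x - y = r *\<^sub>R (((1/2 - \<eta>) * sin15 - (1/2 + \<eta>) * t) *\<^sub>R direction (\<theta> + pi / 2)
        - (2 * \<eta> * cos15) *\<^sub>R direction \<theta>)"
      unfolding x_def y_def p_def q_def
      by (simp add: vec_eq_iff forall_2 edge_point_nth cos_add sin_add) (simp add: algebra_simps)
    also have "\<dots> = (2 * \<eta> * cos15 / sin15) *\<^sub>R (r *\<^sub>R edge_point (\<theta> + pi / 2) sin15)"
      unfolding key using sin15_pos
      by (simp add: vec_eq_iff forall_2 edge_point_nth cos_add sin_add) (simp add: field_simps)
    finally show ?thesis .
  qed
  have N2: "N (x - y) = 2 * \<eta> * cos15 / sin15"
    unfolding xmy N_scale using N3[of sin15] a3 sin15_pos cos15_pos \<eta> by (simp add: N_scale)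
  have "(N x + N y) / N (x - y) * N (x /\<^sub>R N x - y /\<^sub>R N y)
      = sin15 * (sin15 - t) / (2 * \<eta> * cos15\<^sup>2)"
    unfolding xu N1 N2 unfolding Nx by (simp add: power2_eq_square)
  also have "\<dots> = W / cos15\<^sup>2"
    using \<eta> cos15_pos by (simp flip: \<eta>W)
  finally have eq: "W / cos15\<^sup>2 = (N x + N y) / N (x - y) * N (x /\<^sub>R N x - y /\<^sub>R N y)" ..
  have "N x \<noteq> 0" "N y \<noteq> 0" unfolding Nx using \<eta> \<eta>2 by linarith+
  then have "x \<noteq> 0" "y \<noteq> 0" unfolding N_eq_0 .
  moreover have "0 < N (x - y)" unfolding N2 using \<eta> sin15_pos cos15_pos by simp
  then have "x \<noteq> y" using N_eq_0[of 0] by auto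
  ultimately show ?thesis using eq unfolding W_def by blast
qed

lemma DW_eq: "DW N = 2 / cos15\<^sup>2"
proof -
  define A where "A = {(N x + N y) / N (x - y) * N (x /\<^sub>R N x - y /\<^sub>R N y) | x y.
                 x \<noteq> 0 \<and> y \<noteq> 0 \<and> x \<noteq> y}"
  have DW: "DW N = Sup A" unfolding DW_def A_def ..
  have ub: "a \<le> 2 / cos15\<^sup>2" if "a \<in> A" for a
    using that ratio_le unfolding A_def by blast
  then have bdd: "bdd_above A" by (rule bdd_aboveI)
  have mem: "(2 * cos15\<^sup>2 + sin15 * (sin15 + t)) / cos15\<^sup>2 \<in> A" if "0 < t" "t < sin15" for t
    using ratio_near_sup[OF that] unfolding A_def by blast
  have "A \<noteq> {}" using mem[of "sin15 / 2"] sin15_pos by auto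
  then have "Sup A \<le> 2 / cos15\<^sup>2" using ub by (rule cSup_least)
  moreover have "2 / cos15\<^sup>2 \<le> Sup A"
  \<comment> \<open>At \<open>t = sin15\<close> the two points of the sphere coincide, so the value
    2 / \<open>cos15\<^sup>2\<close> is reached only as a limit from the left.\<close>
  proof (rule tendsto_upperbound)
    let ?f = "\<lambda>t. (2 * cos15\<^sup>2 + sin15 * (sin15 + t)) / cos15\<^sup>2"
    have "(?f \<longlongrightarrow> (2 * cos15\<^sup>2 + sin15 * (sin15 + sin15)) / cos15\<^sup>2) (at_left sin15)"
      using cos15_pos by (intro tendsto_intros) auto
    moreover have "2 * cos15\<^sup>2 + sin15 * (sin15 + sin15) = 2"
      using sin_cos_squared_add[of "pi/12"] by (simp add: power2_eq_square)
    ultimately show "(?f \<longlongrightarrow> 2 / cos15\<^sup>2) (at_left sin15)" by simp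
    show "\<forall>\<^sub>F t in at_left sin15. ?f t \<le> Sup A"
      using eventually_at_left_real[OF sin15_pos]
      by eventually_elim (auto intro!: cSup_upper[OF _ bdd] mem)
  qed simp
  ultimately show ?thesis unfolding DW by linarith
qed

end

section \<open>From the regular polygon to the edge description of the sphere\<close>

lemma regular_dodecagon_dodecagon_norm:
  assumes N: "is_norm N" and P: "regular_polygon 12 P" and S: "unit_sphere N = frontier P"
  shows "\<exists>r \<theta>. dodecagon_norm N r \<theta>"
proof -
  obtain c r \<theta> where r: "0 < r" and P_eq: "P = convex hull
      ((\<lambda>k. c + r *\<^sub>R vector [cos (\<theta> + 2 * pi * real k / real 12),
                                    sin (\<theta> + 2 * pi * real k / real 12)]) ` {..<12})"
    using P unfolding regular_polygon_def by blast
  \<comment> \<open>Vertices are indexed by all integers; \<open>\<alpha> k\<close> is the outward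
    normal of the edge from \<open>w k\<close> to \<open>w (k + 1)\<close>.\<close>
  define w :: "int \<Rightarrow> real^2" where "w k = c + r *\<^sub>R direction (\<theta> + of_int k * pi / 6)" for k
  define \<alpha> where "\<alpha> k = \<theta> + pi / 12 + of_int k * pi / 6" for k :: int
  have w_in: "w k \<in> (\<lambda>k. w (int k)) ` {..<12}" for k
  proof -
    have "\<theta> + of_int k * pi / 6 = (\<theta> + of_int (k mod 12) * pi / 6) + 2 * pi * of_int (k div 12)"
    proof -
      have "real_of_int k = of_int (12 * (k div 12) + k mod 12)" by simp
      also have "\<dots> = 12 * of_int (k div 12) + of_int (k mod 12)"
        unfolding of_int_add of_int_mult by simp
      finally have "real_of_int k = 12 * of_int (k div 12) + of_int (k mod 12)" .
      then show ?thesis by (simp add: field_simps)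
    qed
    then have "direction (\<theta> + of_int k * pi / 6) = direction (\<theta> + of_int (k mod 12) * pi / 6)"
      by (simp only: direction_add_2pi_int)
    then have "w k = w (int (nat (k mod 12)))"
      by (simp add: w_def)
    then show ?thesis by (intro image_eqI[where x = "nat (k mod 12)"]) auto
  qed
  have P_hull: "P = convex hull ((\<lambda>k. w (int k)) ` {..<12})"
    unfolding P_eq w_def direction_def
    by (intro arg_cong[where f = "\<lambda>A. convex hull A"] image_cong refl) (simp add: field_simps)
  \<comment> \<open>These angles are odd multiples of pi/12, none closer than pi/12 to a multiple of
    2 pi.\<close>
  have cosle: "cos (pi / 12 + of_int j * pi / 6) \<le> cos15" for j :: int
  proof -
    have "cos (pi / 12 + of_int j * pi / 6) = cos (pi / 12 + of_int (j mod 12) * pi / 6)"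
    proof -
      have "real_of_int j = of_int (12 * (j div 12) + j mod 12)" by simp
      also have "\<dots> = 12 * of_int (j div 12) + of_int (j mod 12)"
        unfolding of_int_add of_int_mult by simp
      finally have "pi / 12 + of_int j * pi / 6 =
          (pi / 12 + of_int (j mod 12) * pi / 6) + 2 * pi * of_int (j div 12)"
        by (simp add: field_simps)
      then show ?thesis using direction_add_2pi_int by (metis direction_nth(1))
    qed
    moreover define i where "i = j mod 12"
    have i: "0 \<le> i" "i \<le> 11" by (auto simp: i_def)
    have "cos (pi / 12 + of_int i * pi / 6) \<le> cos15"
    proof (cases "i \<le> 5")
      case True
      then have "real_of_int i * pi \<le> 5 * pi" by simp
      then have "pi / 12 + of_int i * pi / 6 \<le> pi" by (simp add: field_simps)
      then show ?thesis using i by (intro cos_monotone_0_pi_le) auto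
    next
      case False
      then have "6 * pi \<le> real_of_int i * pi" "real_of_int i * pi \<le> 11 * pi" using i by auto
      then have "pi / 12 \<le> 2 * pi - (pi / 12 + of_int i * pi / 6)"
        "2 * pi - (pi / 12 + of_int i * pi / 6) \<le> pi" by (simp_all add: field_simps)
      then have "cos (2 * pi - (pi / 12 + of_int i * pi / 6)) \<le> cos15"
        by (intro cos_monotone_0_pi_le) auto
      then show ?thesis by (simp only: cos_2pi_minus)
    qed
    ultimately show ?thesis by (simp add: i_def)
  qed
  have support: "inner (direction (\<alpha> k)) (x - c) \<le> r * cos15" if "x \<in> P" for x k
  proof -
    let ?H = "{x. inner (direction (\<alpha> k)) x \<le> inner (direction (\<alpha> k)) c + r * cos15}"
    have "w j \<in> ?H" for j
    proof -
      have "\<alpha> k - (\<theta> + of_int j * pi / 6) = pi / 12 + of_int (k - j) * pi / 6"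
        by (simp add: \<alpha>_def field_simps)
      then show ?thesis using cosle[of "k - j"] r
        by (simp add: w_def inner_add_right inner_direction)
    qed
    then have "P \<subseteq> ?H"
      unfolding P_hull by (intro hull_minimal convex_halfspace_le) auto
    then show ?thesis using that by (auto simp: inner_diff_right)
  qed
  have edge: "c + r *\<^sub>R edge_point (\<alpha> k) s \<in> frontier P" if s: "\<bar>s\<bar> \<le> sin15" for k s
  proof -
    define x where "x = c + r *\<^sub>R edge_point (\<alpha> k) s"
    \<comment> \<open>The barycentric coordinate of \<open>x\<close> on its edge: 0 at offset
      \<open>- sin15\<close>, 1 at offset \<open>sin15\<close>.\<close>
    define l where "l = (1 + s / sin15) / 2"
    have l: "0 \<le> l" "l \<le> 1" using s sin15_pos by (auto simp: l_def field_simps abs_le_iff)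
    have "\<theta> + of_int k * pi / 6 = \<alpha> k - pi / 12"
      "\<theta> + of_int (k + 1) * pi / 6 = \<alpha> k + pi / 12"
      by (simp_all add: \<alpha>_def field_simps)
    then have ends: "w k = c + r *\<^sub>R edge_point (\<alpha> k) (- sin15)"
      "w (k + 1) = c + r *\<^sub>R edge_point (\<alpha> k) sin15"
      unfolding edge_point_vertices w_def by (simp_all only:)
    have s_eq: "s = (2 * l - 1) * sin15" using sin15_pos by (simp add: l_def field_simps)
    have "x = (1 - l) *\<^sub>R w k + l *\<^sub>R w (k + 1)"
      unfolding x_def ends s_eq by (simp add: vec_eq_iff forall_2 edge_point_nth algebra_simps)
    moreover have "w j \<in> P" for j unfolding P_hull by (intro hull_inc w_in)
    moreover have "convex P" unfolding P_hull by (rule convex_convex_hull)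
    ultimately have xP: "x \<in> P"
      using l by (simp add: convex_alt)
    have val: "inner (direction (\<alpha> k)) (x - c) = r * cos15"
      by (simp add: x_def edge_point_def inner_add_right inner_direction)
    \<comment> \<open>The functional in \<open>support\<close> attains its bound at
      \<open>x\<close>, so any move along the outward normal leaves \<open>P\<close>.\<close>
    have "x \<notin> interior P"
    proof
      assume "x \<in> interior P"
      then obtain e where e: "0 < e" "cball x e \<subseteq> P" by (auto simp: mem_interior_cball)
      have "x + e *\<^sub>R direction (\<alpha> k) \<in> P" using e by (intro subsetD[OF e(2)]) (simp add: dist_norm)
      from support[OF this, of k] have "r * cos15 + e \<le> r * cos15"
        using val by (simp add: inner_diff_right inner_add_right inner_direction)
      with e show False by simp
    qed
    then show ?thesis using xP closure_subset unfolding frontier_def x_def by blast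
  qed
  have scale: "N (a *\<^sub>R x) = \<bar>a\<bar> * N x" for a x using N by (simp add: is_norm_def)
  have front: "x \<in> frontier P \<longleftrightarrow> N x = 1" for x using S by (auto simp: unit_sphere_def)
  have "closed P" unfolding P_hull by (intro compact_imp_closed finite_imp_compact_convex_hull) simp
  then have fP: "frontier P \<subseteq> P" by (simp add: frontier_subset_closed)
  have \<alpha>_add_6: "\<alpha> (k + 6) = \<alpha> k + pi" for k by (simp add: \<alpha>_def field_simps)
  text \<open>The support values of the centrally symmetric sphere in opposite directions agree.\<close>
  have le0: "inner (direction (\<alpha> k)) c \<le> 0" for k
  proof -
    \<comment> \<open>Testing the reflected edge midpoint against the opposite normal gives \<open>r
      * cos15 + 2 * inner (direction (\<alpha> k)) c \<le> r * cos15\<close>.\<close>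
    let ?p = "c + r *\<^sub>R edge_point (\<alpha> k) 0"
    have "N ?p = 1" using edge[of 0 k] sin15_pos front by simp
    then have "N (- ?p) = 1" using scale[of "-1" ?p] by simp
    then have "- ?p \<in> P" using front fP by blast
    from support[OF this, of "k + 6"] have "inner (direction (\<alpha> k + pi)) (- ?p - c) \<le> r * cos15"
      by (simp only: \<alpha>_add_6)
    then show ?thesis
      unfolding direction_add_pi edge_point_def inner_minus_left inner_minus_right inner_diff_right
        inner_add_right inner_scaleR_right inner_direction by simp
  qed
  have eq0: "inner (direction (\<alpha> k)) c = 0" for k
  proof -
    show ?thesis using le0[of k] le0[of "k + 6"] by (simp add: \<alpha>_add_6 direction_add_pi)
  qed
  have c0: "c = 0"
  proof -
    obtain \<phi> where \<phi>: "c = norm c *\<^sub>R direction \<phi>" by (rule direction_polar)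
    \<comment> \<open>Edges 0 and 3 have perpendicular normals, and a vector orthogonal to both
      vanishes.\<close>
    have "\<alpha> 3 = \<alpha> 0 + pi / 2" by (simp add: \<alpha>_def)
    then have a3: "\<alpha> 3 - \<phi> = (\<alpha> 0 - \<phi>) + pi / 2" by simp
    have nc: "norm c * cos (\<alpha> k - \<phi>) = 0" for k
    proof -
      have "inner (direction (\<alpha> k)) c = inner (direction (\<alpha> k)) (norm c *\<^sub>R direction \<phi>)"
        using \<phi> by (rule arg_cong)
      then show ?thesis using eq0[of k] by (simp add: inner_direction)
    qed
    have "norm c * sin (\<alpha> 0 - \<phi>) = 0" using nc[of 3] unfolding a3 cos_add by simp
    with nc[of 0] have "norm c = 0"
      by (auto dest: sin_zero_abs_cos_one)
    then show ?thesis by simp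
  qed
  have on: "N (r *\<^sub>R edge_point (\<alpha> k) s) = 1" if "\<bar>s\<bar> \<le> sin15" for k s
    using edge[OF that, of k] front c0 by simp
  text \<open>Every ray meets an edge, and it meets the unit sphere only once.\<close>
  have "\<exists>(k::int) s. \<bar>s\<bar> \<le> sin15 \<and> x = r *\<^sub>R edge_point (\<alpha> k) s" if x: "N x = 1" for x
  proof -
    obtain \<phi> where \<phi>: "x = norm x *\<^sub>R direction \<phi>" by (rule direction_polar)
    have x0: "0 < norm x" using x scale[of 0 x] by auto
    \<comment> \<open>The index of the sector between consecutive vertices that contains the ray;
      \<psi> is then its angle from the edge normal.\<close>
    define k where "k = \<lfloor>(\<phi> - \<theta>) / (pi / 6)\<rfloor>"
    define \<psi> where "\<psi> = \<phi> - \<alpha> k"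
    have "of_int k \<le> (\<phi> - \<theta>) / (pi / 6)" "(\<phi> - \<theta>) / (pi / 6) \<le> of_int k + 1"
      unfolding k_def by linarith+
    then have "of_int k * (pi / 6) \<le> \<phi> - \<theta>" "\<phi> - \<theta> \<le> (of_int k + 1) * (pi / 6)"
      by (simp_all add: pos_le_divide_eq pos_divide_le_eq)
    then have \<psi>: "- (pi / 12) \<le> \<psi>" "\<psi> \<le> pi / 12"
      by (simp_all add: \<psi>_def \<alpha>_def field_simps)
    have cp: "0 < cos \<psi>" using \<psi> by (intro cos_gt_zero_pi) (use pi_gt_zero in linarith)+
    \<comment> \<open>The offset at which a ray at angle \<psi> from the normal meets a line at
      distance \<open>cos15\<close>.\<close>
    define s where "s = cos15 * tan \<psi>"
    have "tan \<psi> \<le> tan (pi / 12)" "tan (- (pi / 12)) \<le> tan \<psi>"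
      using \<psi> pi_gt_zero by (intro tan_mono_le; linarith)+
    then have "\<bar>tan \<psi>\<bar> \<le> tan (pi / 12)" by auto
    then have "cos15 * \<bar>tan \<psi>\<bar> \<le> cos15 * tan (pi / 12)" using cos15_pos by simp
    then have s: "\<bar>s\<bar> \<le> sin15" using cos15_pos by (simp add: s_def abs_mult tan_def)
    have "direction \<phi> = direction (\<alpha> k + \<psi>)" by (simp add: \<psi>_def)
    also have "\<dots> = (cos \<psi> / cos15) *\<^sub>R edge_point (\<alpha> k) s"
      using cp cos15_pos
      by (simp add: vec_eq_iff forall_2 edge_point_nth s_def tan_def cos_add sin_add field_simps)
    finally have "x = (norm x * (cos \<psi> / cos15) / r) *\<^sub>R (r *\<^sub>R edge_point (\<alpha> k) s)"
      using \<phi> r by simp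
    moreover define m where "m = norm x * (cos \<psi> / cos15) / r"
    ultimately have xm: "x = m *\<^sub>R (r *\<^sub>R edge_point (\<alpha> k) s)" by simp
    have "0 < m" unfolding m_def using x0 cp cos15_pos r by simp
    then have "m = 1" using x unfolding xm scale[of m] on[OF s] by simp
    with xm s show ?thesis by auto
  qed
  then have "N x = 1 \<longleftrightarrow> (\<exists>(k::int) s. \<bar>s\<bar> \<le> sin15 \<and> x = r *\<^sub>R edge_point (\<alpha> k) s)" for x
    using on by blast
  \<comment> \<open>The shift by pi/12 passes from a vertex angle to the next edge normal.\<close>
  then have "dodecagon_norm N r (\<theta> + pi / 12)"
    unfolding \<alpha>_def by unfold_locales (use N r in auto)
  then show ?thesis by blast
qed

theorem mainTheorem4:
  fixes N :: "real^2 \<Rightarrow> real" and P :: "(real^2) set"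
  assumes "is_norm N"
    and "regular_polygon 12 P"
    and "unit_sphere N = frontier P"
  shows "DW N = 8 * (2 - sqrt 3) \<and>
    (\<forall>u\<in>unit_sphere N. \<forall>v\<in>unit_sphere N. u + v \<noteq> 0 \<longrightarrow> dw N u v < DW N)"
proof -
  obtain r \<theta> where "dodecagon_norm N r \<theta>"
    using regular_dodecagon_dodecagon_norm[OF assms] by blast
  then interpret dodecagon_norm N r \<theta> .
  show ?thesis
    using dw_less by (auto simp: DW_eq two_div_cos15_sq unit_sphere_def)
qed

end
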